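(* Suppose that $\mathcal{F}\subset 2^{[n]}$ is a family with $|F\,\Delta\, F'|\leq w$ for all $F,F'\in\mathcal{F}$. (i) If $w=2s$, then $\beta(\mathcal{F})\leq\sum_{0\leq j\leq s-1}\binom{n-2}{j}$. (ii) If $w=2s+1$, then $\beta(\mathcal{F})\leq\sum_{0\leq j\leq s-1}\binom{n-2}{j}+\binom{n-3}{s-1}$.
   Context: $2^{[n]}$ is the power set of $[n]=\{1,\dots,n\}$, $n\geq 2$, and $A\,\Delta\, B=(A\setminus B)\cup(B\setminus A)$. For distinct $i,j\in[n]$, let $b_{ij}(\mathcal{F})=|\{F\in\mathcal{F}\colon i\in F,\ j\notin F\}|$; the sturdiness is $\beta(\mathcal{F})=\min_{1\leq i\neq j\leq n} b_{ij}(\mathcal{F})$.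
   Formalization: The formal theorem adds the hypothesis w < n; without it the claim fails, e.g. n = w = 4, s = 2, F = 2^[4] has sturdiness 4 but the bound in (i) is 3. For w ≥ n the diameter condition is vacuous. *)

theory Defs
  imports Main
begin

definition bdeg :: "nat set set \<Rightarrow> nat \<Rightarrow> nat \<Rightarrow> nat" where
  "bdeg \<F> i j = card {F \<in> \<F>. i \<in> F \<and> j \<notin> F}"

(* The set of pairs (i, j) is nonempty for n >= 2; for n < 2 the value of Min is unspecified. *)
definition sturdiness :: "nat \<Rightarrow> nat set set \<Rightarrow> nat" where
  "sturdiness n \<F> = Min {bdeg \<F> i j | i j. i \<in> {1..n} \<and> j \<in> {1..n} \<and> i \<noteq> j}"

end

theory Submission
  imports Defs
begin

text \<open>
  For a pair \<open>i \<noteq> j\<close>, the traces on \<open>S = [n] - {i, j}\<close> of the members containing \<open>i\<close> but not \<open>j\<close>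
  and of those containing \<open>j\<close> but not \<open>i\<close> are two families at mutual distance at most \<open>w - 2\<close>. If one
  of them is larger than a Hamming ball of half that diameter, then, by Harper's vertex
  isoperimetric inequality, a suitable neighbourhood of it leaves so little room for the complements
  of the members of the other family that the latter is at most as large as that ball.

  The instance of Harper's theorem needed here is proved by induction on the dimension. Fix a
  coordinate \<open>a\<close>, and let \<open>A0\<close> and \<open>A1\<close> consist of the members of \<open>A\<close> avoiding \<open>a\<close>, and of those
  containing \<open>a\<close>, with \<open>a\<close> removed. Two-point compressions
  \<open>F \<mapsto> F \<Delta> D\<close> with \<open>a \<in> D\<close>, \<open>|D| \<le> 2\<close> allow us to assume that the neighbourhood of \<open>A1\<close> lies in
  \<open>A0\<close>. Then \<open>A0\<close> is large, and the neighbourhood of \<open>A\<close> contains that of \<open>A0\<close> and \<open>{F + a | F \<in> A0}\<close>.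
\<close>

section \<open>Neighbourhoods and two-point compressions\<close>

definition nbhd :: "'a set \<Rightarrow> 'a set set \<Rightarrow> 'a set set" where
  "nbhd S A = {G. G \<subseteq> S \<and> (\<exists>F\<in>A. card (sym_diff F G) \<le> 1)}"

text \<open>Each pair \<open>F\<close>, \<open>sym_diff F D\<close> keeps its number of members; for
  \<open>a \<in> D\<close>, a lone member of a pair is placed on the set avoiding
  \<open>a\<close>.\<close>

definition compress :: "'a \<Rightarrow> 'a set \<Rightarrow> 'a set set \<Rightarrow> 'a set set" where
  "compress a D A =
    {F. if a \<in> F then F \<in> A \<and> sym_diff F D \<in> A else F \<in> A \<or> sym_diff F D \<in> A}"

lemma sym_diff_cancel [simp]: "sym_diff (sym_diff F D) D = F"
  by blast

lemma sym_diff_cancel_both [simp]: "sym_diff (sym_diff F D) (sym_diff G D) = sym_diff F G"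
  by blast

lemma nbhdI: "F \<in> A \<Longrightarrow> G \<subseteq> S \<Longrightarrow> card (sym_diff F G) \<le> 1 \<Longrightarrow> G \<in> nbhd S A"
  by (auto simp: nbhd_def)

lemma nbhdE:
  assumes "G \<in> nbhd S A"
  obtains F where "F \<in> A" "G \<subseteq> S" "card (sym_diff F G) \<le> 1"
  using assms by (auto simp: nbhd_def)

lemma nbhd_subset: "nbhd S A \<subseteq> Pow S"
  by (auto simp: nbhd_def)

lemma subset_nbhd: "A \<subseteq> Pow S \<Longrightarrow> A \<subseteq> nbhd S A"
  by (force simp: nbhd_def)

lemma compress_subset: "A \<subseteq> Pow S \<Longrightarrow> D \<subseteq> S \<Longrightarrow> compress a D A \<subseteq> Pow S"
  unfolding compress_def by (auto split: if_splits)

lemma card_compress: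
  assumes "finite A" "a \<in> D"
  shows "card (compress a D A) = card A"
proof -
  let ?m = "\<lambda>F. if a \<in> F \<and> sym_diff F D \<notin> A then sym_diff F D else F"
  have inj: "inj_on ?m A"
  proof (rule inj_onI)
    fix F G assume "F \<in> A" "G \<in> A" "?m F = ?m G"
    then show "F = G"
      by (metis sym_diff_cancel)
  qed
  have image: "?m ` A = compress a D A"
  proof
    show "?m ` A \<subseteq> compress a D A"
      using assms(2) by (auto simp: compress_def)
    show "compress a D A \<subseteq> ?m ` A"
    proof
      fix G assume G: "G \<in> compress a D A"
      show "G \<in> ?m ` A"
      proof (cases "G \<in> A")
        case True
        then have "G = ?m G" using G by (auto simp: compress_def)
        then show ?thesis using True by (rule image_eqI)
      next
        case False
        then have GD: "a \<notin> G" "sym_diff G D \<in> A"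
          using G by (auto simp: compress_def split: if_splits)
        then have "a \<in> sym_diff G D" using assms(2) by blast
        then have "G = ?m (sym_diff G D)" using False by (simp only: sym_diff_cancel simp_thms if_True)
        then show ?thesis using GD(2) by (rule image_eqI)
      qed
    qed
  qed
  show ?thesis using card_image[OF inj] unfolding image .
qed

text \<open>Taking \<open>sym_diff\<close> with \<open>D\<close> preserves distances, so the only
  delicate case is \<open>a \<notin> F\<close>, \<open>a \<in> G\<close>. There
  \<open>G = insert a F\<close>, and the crossed pairs differ exactly in \<open>D - {a}\<close>,
  which \<open>card D \<le> 2\<close> keeps within distance 1.\<close>

lemma nbhd_compress_subset:
  assumes "finite S" "A \<subseteq> Pow S" "a \<in> D" "D \<subseteq> S" "card D \<le> 2"
  shows "nbhd S (compress a D A) \<subseteq> compress a D (nbhd S A)"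
proof
  fix G assume "G \<in> nbhd S (compress a D A)"
  then obtain F where G: "G \<subseteq> S" and F: "F \<in> compress a D A" and d: "card (sym_diff F G) \<le> 1"
    by (auto simp: nbhd_def)
  have GD: "sym_diff G D \<subseteq> S" using G assms(4) by blast
  have FS: "F \<subseteq> S" using F compress_subset[OF assms(2,4)] by blast
  have near: "G \<in> nbhd S A" if "F \<in> A"
    using that G d by (rule nbhdI)
  have near_D: "sym_diff G D \<in> nbhd S A" if "sym_diff F D \<in> A"
    using that GD by (rule nbhdI) (use d in \<open>simp only: sym_diff_cancel_both\<close>)
  show "G \<in> compress a D (nbhd S A)"
  proof (cases "a \<in> F \<or> a \<notin> G")
    case True
    then show ?thesis using F near near_D by (auto simp: compress_def split: if_splits)
  next
    case False
    have fin: "finite (sym_diff F G)"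
      using FS G assms(1) by (meson finite_Diff finite_UnI finite_subset)
    have single: "{a} = sym_diff F G"
      by (rule card_seteq[OF fin]) (use False d in auto)
    have "G = sym_diff F (sym_diff F G)" by blast
    also have "\<dots> = insert a F" unfolding single[symmetric] using False by auto
    finally have G_eq: "G = insert a F" .
    have diff: "sym_diff F (sym_diff G D) = D - {a}" "sym_diff (sym_diff F D) G = D - {a}"
      unfolding G_eq using False assms(3) by auto
    have card: "card (D - {a}) \<le> 1"
      using assms(3,5) by simp
    have "sym_diff G D \<in> nbhd S A" if "F \<in> A"
      using that GD by (rule nbhdI) (simp only: diff card)
    moreover have "G \<in> nbhd S A" if "sym_diff F D \<in> A"
      using that G by (rule nbhdI) (simp only: diff card)
    ultimately show ?thesis
      using near near_D F False by (auto simp: compress_def split: if_splits)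
  qed
qed

text \<open>Among the candidates, one with the fewest members containing \<open>a\<close> is stable:
  a compression moving such a member would yield a candidate with fewer.\<close>

lemma exists_compressed:
  assumes "finite S" "a \<in> S" "A \<subseteq> Pow S"
  obtains A' where "A' \<subseteq> Pow S" "card A' = card A" "card (nbhd S A') \<le> card (nbhd S A)"
    "\<And>D F. a \<in> D \<Longrightarrow> D \<subseteq> S \<Longrightarrow> card D \<le> 2 \<Longrightarrow> F \<in> A' \<Longrightarrow> a \<in> F \<Longrightarrow> sym_diff F D \<in> A'"
proof -
  define P where "P A' \<longleftrightarrow>
    A' \<subseteq> Pow S \<and> card A' = card A \<and> card (nbhd S A') \<le> card (nbhd S A)" for A'
  define \<mu> where "\<mu> A' = card {F\<in>A'. a \<in> F}" for A'
  have "P A" using assms(3) by (simp add: P_def)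
  from ex_has_least_nat[of P, OF this, of \<mu>]
  obtain A' where "P A'" and min: "\<And>B. P B \<Longrightarrow> \<mu> A' \<le> \<mu> B" by blast
  then have P: "A' \<subseteq> Pow S" "card A' = card A" "card (nbhd S A') \<le> card (nbhd S A)"
    by (simp_all add: P_def)
  have fin: "finite A'" using P(1) assms(1) by (meson finite_Pow_iff finite_subset)
  have stable: "sym_diff F D \<in> A'"
    if D: "a \<in> D" "D \<subseteq> S" "card D \<le> 2" and F: "F \<in> A'" "a \<in> F" for D F
  proof (rule ccontr)
    assume F_out: "sym_diff F D \<notin> A'"
    let ?C = "compress a D A'"
    have "{G\<in>?C. a \<in> G} \<subset> {G\<in>A'. a \<in> G}"
      using F F_out by (auto simp: compress_def)
    then have "\<mu> ?C < \<mu> A'" using fin by (simp add: \<mu>_def psubset_card_mono)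
    moreover have "P ?C"
      unfolding P_def
    proof (intro conjI)
      show "?C \<subseteq> Pow S" using P(1) D(2) by (rule compress_subset)
      show "card ?C = card A" using P(2) card_compress[OF fin D(1)] by simp
      have fN: "finite (nbhd S A')"
        using nbhd_subset assms(1) by (metis finite_Pow_iff finite_subset)
      have "finite (compress a D (nbhd S A'))"
        using compress_subset[OF nbhd_subset D(2)] assms(1) by (metis finite_Pow_iff finite_subset)
      then have "card (nbhd S ?C) \<le> card (compress a D (nbhd S A'))"
        using nbhd_compress_subset[OF assms(1) P(1) D] by (rule card_mono)
      also have "\<dots> \<le> card (nbhd S A)" using P(3) card_compress[OF fN D(1)] by simp
      finally show "card (nbhd S ?C) \<le> card (nbhd S A)" .
    qed
    ultimately show False using min[of ?C] by linarith
  qed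
  from that[OF P stable] show thesis .
qed

section \<open>Binomial sums and the vertex isoperimetric inequality\<close>

lemma sum_choose_Suc:
  "(\<Sum>j<Suc t. Suc k choose j) = (\<Sum>j<Suc t. k choose j) + (\<Sum>j<t. k choose j)"
  by (induction t) auto

text \<open>Reflecting row \<open>k\<close> turns the second sum into its top \<open>t\<close>
  terms: the complement of a Hamming ball is a ball around the antipode.\<close>

lemma sum_choose_complement:
  assumes "t \<le> Suc k"
  shows "(\<Sum>j<Suc k - t. k choose j) + (\<Sum>j<t. k choose j) = 2 ^ k"
proof -
  have "(\<Sum>j<t. k choose j) = (\<Sum>j\<in>{Suc k - t..<Suc k}. k choose j)"
    by (rule sum.reindex_bij_witness[of _ "\<lambda>j. k - j" "\<lambda>j. k - j"])
       (use assms in \<open>auto simp: binomial_symmetric[symmetric]\<close>)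
  then have "(\<Sum>j<Suc k - t. k choose j) + (\<Sum>j<t. k choose j) = (\<Sum>j<Suc k. k choose j)"
    using sum.atLeastLessThan_concat[of 0 "Suc k - t" "Suc k" "\<lambda>j. k choose j"]
    by (simp add: atLeast0LessThan)
  also have "\<dots> = 2 ^ k" by (simp only: lessThan_Suc_atMost choose_row_sum)
  finally show ?thesis .
qed

text \<open>
  The parameter \<open>c\<close> distinguishes Hamming balls (\<open>c = 0\<close>) from products of a ball with an edge of the
  cube (\<open>c = 1\<close>); these are the extremal configurations for even and odd diameter.
\<close>

lemma vertex_isoperimetry:
  fixes S :: "'a set"
  assumes "finite S" "card S = k + c" "c \<le> 1" "A \<subseteq> Pow S" "A \<noteq> {}"
    and "2 ^ c * (\<Sum>j<t. k choose j) \<le> card A"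
  shows "2 ^ c * (\<Sum>j<Suc t. k choose j) \<le> card (nbhd S A)"
  using assms
proof (induction k arbitrary: S A t)
  case 0
  \<comment> \<open>The cube has dimension \<open>c \<le> 1\<close>, so a single member is within
    distance 1 of every subset of \<open>S\<close>.\<close>
  obtain F where F: "F \<in> A" using 0 by blast
  have "G \<in> nbhd S A" if "G \<subseteq> S" for G
  proof -
    have "sym_diff F G \<subseteq> S" using that F 0 by blast
    then have "card (sym_diff F G) \<le> 1"
      using 0 card_mono[of S "sym_diff F G"] by simp
    then show ?thesis using F that by (auto simp: nbhd_def)
  qed
  then have "nbhd S A = Pow S" using nbhd_subset by blast
  moreover have "(\<Sum>j<Suc t. 0 choose j) = (1::nat)"
    by (induction t) auto
  ultimately show ?case using 0 by (simp add: card_Pow del: sum.lessThan_Suc)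
next
  case (Suc k)
  let ?g = "\<lambda>t. 2 ^ c * (\<Sum>j<t. k choose j)"
  obtain a where a: "a \<in> S" using Suc.prems(2) by (metis add_Suc card.empty equals0I nat.simps(3))
  define S' where "S' = S - {a}"
  have S: "S = insert a S'" "a \<notin> S'" "finite S'" "card S' = k + c"
    using a Suc.prems by (auto simp: S'_def)
  obtain A' where A': "A' \<subseteq> Pow S" "card A' = card A" "card (nbhd S A') \<le> card (nbhd S A)"
    and stable: "\<And>D F. a \<in> D \<Longrightarrow> D \<subseteq> S \<Longrightarrow> card D \<le> 2 \<Longrightarrow> F \<in> A' \<Longrightarrow> a \<in> F \<Longrightarrow> sym_diff F D \<in> A'"
    using exists_compressed[OF Suc.prems(1) a Suc.prems(4)] by blast
  have fin: "finite B" if "B \<subseteq> Pow S" for B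
    using that Suc.prems(1) by (meson finite_Pow_iff finite_subset)
  define A0 where "A0 = {F\<in>A'. a \<notin> F}"
  define A1 where "A1 = (\<lambda>F. F - {a}) ` {F\<in>A'. a \<in> F}"
  have sub: "A0 \<subseteq> Pow S'" "A1 \<subseteq> Pow S'"
    using A'(1) by (auto simp: A0_def A1_def S'_def)
  have fin0: "finite A0" using fin[OF A'(1)] by (simp add: A0_def)
  have "inj_on (\<lambda>F. F - {a}) {F\<in>A'. a \<in> F}"
    by (rule inj_onI) blast
  then have "card A1 = card {F\<in>A'. a \<in> F}" by (simp add: A1_def card_image)
  moreover have "card A' = card A0 + card {F\<in>A'. a \<in> F}"
    unfolding A0_def using fin[OF A'(1)]
    by (subst card_Un_disjoint[symmetric]) (auto intro: arg_cong[where f = card])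
  ultimately have card_A: "card A = card A0 + card A1" using A'(2) by simp
  have nb1: "nbhd S' A1 \<subseteq> A0"
  proof
    fix G assume "G \<in> nbhd S' A1"
    then obtain F where G: "G \<subseteq> S'" and F: "F \<in> A'" "a \<in> F" and d: "card (sym_diff (F - {a}) G) \<le> 1"
      by (auto simp: nbhd_def A1_def)
    \<comment> \<open>This \<open>D\<close> removes \<open>a\<close> from \<open>F\<close> and makes
      the one further change leading to \<open>G\<close>, which is why compressions with
      \<open>card D = 2\<close> are required.\<close>
    define D where "D = insert a (sym_diff (F - {a}) G)"
    have D: "a \<in> D" "D \<subseteq> S" "card D \<le> 2"
      using a G F A'(1) d card_insert_le_m1[of 2 "sym_diff (F - {a}) G" a]
      by (auto simp: D_def S'_def)
    have "sym_diff F D = G" using F G S(2) by (auto simp: D_def)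
    then show "G \<in> A0" using stable[OF D F] G S(2) by (auto simp: A0_def)
  qed
  \<comment> \<open>Otherwise Pascal's rule leaves \<open>A1\<close> more than
    \<open>?g (t - 1)\<close> members, and its neighbourhood, contained in \<open>A0\<close>, has at
    least \<open>?g t\<close>.\<close>
  have A0_large: "?g t \<le> card A0"
  proof (rule ccontr)
    assume less: "\<not> ?g t \<le> card A0"
    then obtain u where u: "t = Suc u" by (cases t) auto
    have "?g t + ?g u \<le> card A"
      using Suc.prems(6) by (simp only: u sum_choose_Suc add_mult_distrib2)
    then have A1: "?g u < card A1" using less card_A by linarith
    then have "A1 \<noteq> {}" by auto
    then have "?g t \<le> card (nbhd S' A1)"
      using Suc.IH[OF S(3,4) Suc.prems(3) sub(2), of u] A1 unfolding u by linarith
    also have "\<dots> \<le> card A0" by (rule card_mono[OF fin0 nb1])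
    finally show False using less by simp
  qed
  \<comment> \<open>For \<open>t = 0\<close> the bound \<open>A0_large\<close> says nothing, so
    nonemptiness is derived separately.\<close>
  have "A0 \<noteq> {}"
  proof
    assume "A0 = {}"
    then have "A1 = {}" using nb1 subset_nbhd[OF sub(2)] by blast
    then have "card A = 0" using \<open>A0 = {}\<close> card_A by simp
    then show False using Suc.prems(5) fin[OF Suc.prems(4)] by simp
  qed
  then have nb0: "?g (Suc t) \<le> card (nbhd S' A0)"
    using Suc.IH[OF S(3,4) Suc.prems(3) sub(1) _ A0_large] by blast
  have inj: "inj_on (insert a) A0"
    unfolding inj_on_def using sub(1) S(2) by (metis PowD insert_ident subsetD)
  have "nbhd S' A0 \<union> insert a ` A0 \<subseteq> nbhd S A'"
  proof -
    have "insert a F \<in> nbhd S A'" if "F \<in> A0" for F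
    proof (rule nbhdI)
      show "F \<in> A'" "insert a F \<subseteq> S" using that sub(1) S(1) by (auto simp: A0_def)
      have "sym_diff F (insert a F) = {a}" using that by (auto simp: A0_def)
      then show "card (sym_diff F (insert a F)) \<le> 1" by simp
    qed
    moreover have "nbhd S' A0 \<subseteq> nbhd S A'"
      by (auto simp: nbhd_def A0_def S(1))
    ultimately show ?thesis by blast
  qed
  then have "card (nbhd S' A0 \<union> insert a ` A0) \<le> card (nbhd S A')"
    by (rule card_mono[OF fin[OF nbhd_subset]])
  moreover have "card (nbhd S' A0 \<union> insert a ` A0) = card (nbhd S' A0) + card A0"
  proof (subst card_Un_disjoint)
    show "finite (nbhd S' A0)" using S(3) nbhd_subset by (metis finite_Pow_iff finite_subset)
    show "nbhd S' A0 \<inter> insert a ` A0 = {}" using S(2) by (auto simp: nbhd_def)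
  qed (use fin0 inj in \<open>auto simp: card_image\<close>)
  ultimately have "?g (Suc t) + ?g t \<le> card (nbhd S A)"
    using nb0 A0_large A'(3) by linarith
  then show ?case by (simp only: sum_choose_Suc add_mult_distrib2)
qed

section \<open>Iterated neighbourhoods and pairs of families at bounded distance\<close>

lemma iterated_nbhd_subset: "A \<subseteq> Pow S \<Longrightarrow> (nbhd S ^^ r) A \<subseteq> Pow S"
  by (cases r) (simp_all add: nbhd_subset)

lemma iterated_isoperimetry:
  assumes "finite S" "card S = k + c" "c \<le> 1" "A \<subseteq> Pow S" "A \<noteq> {}"
    and "2 ^ c * (\<Sum>j<t. k choose j) \<le> card A"
  shows "(nbhd S ^^ r) A \<noteq> {} \<and> 2 ^ c * (\<Sum>j<t + r. k choose j) \<le> card ((nbhd S ^^ r) A)"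
proof (induction r)
  case (Suc r)
  let ?N = "(nbhd S ^^ r) A"
  have "?N \<subseteq> Pow S" by (rule iterated_nbhd_subset[OF assms(4)])
  then show ?case
    using vertex_isoperimetry[OF assms(1-3), of ?N "t + r"] subset_nbhd[of ?N S] Suc by auto
qed (use assms in simp)

lemma iterated_nbhd_dist:
  assumes "finite S" "A \<subseteq> Pow S" "G \<in> (nbhd S ^^ r) A"
  shows "\<exists>F\<in>A. card (sym_diff F G) \<le> r"
  using assms(3)
proof (induction r arbitrary: G)
  case (Suc r)
  then obtain H where H: "H \<in> (nbhd S ^^ r) A" "card (sym_diff H G) \<le> 1" and G: "G \<subseteq> S"
    by (auto elim: nbhdE)
  obtain F where F: "F \<in> A" "card (sym_diff F H) \<le> r" using Suc.IH[OF H(1)] by blast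
  have "H \<subseteq> S" using H(1) iterated_nbhd_subset[OF assms(2)] by blast
  moreover have "F \<subseteq> S" using F(1) assms(2) by blast
  ultimately have "finite (sym_diff F H \<union> sym_diff H G)"
    using assms(1) G by (meson finite_Diff finite_UnI finite_subset)
  then have "card (sym_diff F G) \<le> card (sym_diff F H \<union> sym_diff H G)"
    by (rule card_mono) blast
  also have "\<dots> \<le> r + 1" using card_Un_le[of "sym_diff F H" "sym_diff H G"] F(2) H(2) by linarith
  finally show ?case using F(1) by auto
qed force

lemma cross_diameter_bound:
  assumes "finite S" "card S = k + c" "c \<le> 1" "A \<subseteq> Pow S" "B \<subseteq> Pow S" "2 * t \<le> k + 1"
    and cross: "\<And>F G. F \<in> A \<Longrightarrow> G \<in> B \<Longrightarrow> card (sym_diff F G) + 2 \<le> 2 * t + c"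
  shows "min (card A) (card B) \<le> 2 ^ c * (\<Sum>j<t. k choose j)"
proof (cases "card A \<le> 2 ^ c * (\<Sum>j<t. k choose j)")
  case False
  \<comment> \<open>For \<open>F \<in> A\<close> and \<open>G \<in> B\<close>, the sets
    \<open>F\<close> and \<open>S - G\<close> differ in at least \<open>k + 2 - 2 * t\<close>
    elements, one more than \<open>r\<close>; hence the \<open>r\<close>-fold neighbourhood of
    \<open>A\<close> misses all complements of members of \<open>B\<close>.\<close>
  define r where "r = Suc k - 2 * t"
  let ?N = "(nbhd S ^^ r) A" and ?B = "(\<lambda>G. S - G) ` B"
  have "A \<noteq> {}" using False by auto
  then have N: "2 ^ c * (\<Sum>j<t + r. k choose j) \<le> card ?N"
    using iterated_isoperimetry[OF assms(1-4), of t r] False by simp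
  have "?N \<inter> ?B = {}"
  proof (rule equals0I)
    fix H assume "H \<in> ?N \<inter> ?B"
    then obtain G where G: "G \<in> B" "S - G \<in> ?N" by blast
    then obtain F where F: "F \<in> A" "card (sym_diff F (S - G)) \<le> r"
      using iterated_nbhd_dist[OF assms(1,4)] by blast
    have FG: "F \<subseteq> S" "G \<subseteq> S" using F G assms(4,5) by auto
    then have "sym_diff F (S - G) = S - sym_diff F G" by blast
    moreover have sub: "sym_diff F G \<subseteq> S" using FG by blast
    ultimately have "card (sym_diff F (S - G)) = k + c - card (sym_diff F G)"
      using card_Diff_subset[OF finite_subset[OF sub assms(1)] sub] assms(2) by simp
    then show False using F(2) cross[OF F(1) G(1)] assms(6) unfolding r_def by linarith
  qed
  moreover have sub: "?N \<subseteq> Pow S" "?B \<subseteq> Pow S"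
    using iterated_nbhd_subset[OF assms(4)] by blast+
  moreover have fin: "finite ?N" "finite ?B"
    using sub assms(1) by (meson finite_Pow_iff finite_subset)+
  ultimately have "card ?N + card ?B \<le> card (Pow S)"
    using assms(1) by (simp add: card_Un_disjoint[symmetric] card_mono)
  moreover have "inj_on (\<lambda>G. S - G) B"
    by (rule inj_onI) (use assms(5) in blast)
  then have "card ?B = card B" by (rule card_image)
  ultimately have "2 ^ c * (\<Sum>j<t + r. k choose j) + card B \<le> 2 ^ (k + c)"
    using N assms(1,2) by (simp add: card_Pow)
  moreover have "t + r = Suc k - t" using assms(6) by (simp add: r_def)
  then have "2 ^ c * (\<Sum>j<t + r. k choose j) + 2 ^ c * (\<Sum>j<t. k choose j) = 2 ^ (k + c)"
    using sum_choose_complement[of t k] assms(6)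
    by (simp add: add_mult_distrib2[symmetric] power_add)
  ultimately show ?thesis by linarith
qed simp

section \<open>From bounded diameter to sturdiness\<close>

lemma sturdiness_le:
  assumes "i \<in> {1..n}" "j \<in> {1..n}" "i \<noteq> j"
  shows "sturdiness n \<F> \<le> bdeg \<F> i j"
proof -
  have "{bdeg \<F> i j | i j. i \<in> {1..n} \<and> j \<in> {1..n} \<and> i \<noteq> j}
      \<subseteq> (\<lambda>(i, j). bdeg \<F> i j) ` ({1..n} \<times> {1..n})"
    by auto
  then have "finite {bdeg \<F> i j | i j. i \<in> {1..n} \<and> j \<in> {1..n} \<and> i \<noteq> j}"
    by (rule finite_subset) simp
  then show ?thesis
    unfolding sturdiness_def using assms by (intro Min_le) auto
qed

text \<open>If \<open>w < 2\<close>, no member can contain \<open>i\<close> but not \<open>j\<close> while another does the opposite, so \<open>t\<close> is free.\<close>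

lemma sturdiness_diameter_bound:
  assumes "\<F> \<subseteq> Pow {1..n}" "\<forall>F\<in>\<F>. \<forall>F'\<in>\<F>. card (sym_diff F F') \<le> w"
    and "w < 2 \<or> w \<le> 2 * t + c"
    and "n = k + c + 2" "c \<le> 1" "2 * t \<le> k + 1"
  shows "sturdiness n \<F> \<le> 2 ^ c * (\<Sum>j<t. k choose j)"
proof -
  \<comment> \<open>A single pair of coordinates suffices; 1 and 2 are chosen.\<close>
  define S where "S = {3..n}"
  have S: "{1..n} = insert 1 (insert 2 S)" using assms(4) by (auto simp: S_def)
  define tr where "tr = (\<lambda>i j. (\<lambda>F. F - {i}) ` {F\<in>\<F>. i \<in> F \<and> j \<notin> F})"
  have card_tr: "card (tr i j) = bdeg \<F> i j" for i j
  proof -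
    have "inj_on (\<lambda>F. F - {i}) {F\<in>\<F>. i \<in> F \<and> j \<notin> F}" by (rule inj_onI) blast
    then show ?thesis by (simp add: tr_def bdeg_def card_image)
  qed
  have "min (card (tr 1 2)) (card (tr 2 1)) \<le> 2 ^ c * (\<Sum>j<t. k choose j)"
  proof (rule cross_diameter_bound[OF _ _ assms(5) _ _ assms(6)])
    show "finite S" "card S = k + c" using assms(4) by (auto simp: S_def)
    show "tr 1 2 \<subseteq> Pow S" "tr 2 1 \<subseteq> Pow S"
      using assms(1)[unfolded S] unfolding tr_def by blast+
  next
    fix F' G' assume "F' \<in> tr 1 2" "G' \<in> tr 2 1"
    then obtain F G where F: "F \<in> \<F>" "1 \<in> F" "2 \<notin> F" "F' = F - {1}"
      and G: "G \<in> \<F>" "2 \<in> G" "1 \<notin> G" "G' = G - {2}"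
      by (auto simp: tr_def)
    have "finite F" "finite G"
      using F(1) G(1) assms(1) by (meson PowD finite_atLeastAtMost finite_subset subsetD)+
    moreover have "sym_diff F G = insert 1 (insert 2 (sym_diff F' G'))"
      using F G by auto
    ultimately have "card (sym_diff F G) = card (sym_diff F' G') + 2"
      using F G by simp
    then have "card (sym_diff F' G') + 2 \<le> w" using assms(2) F(1) G(1) by metis
    then show "card (sym_diff F' G') + 2 \<le> 2 * t + c" using assms(3) by linarith
  qed
  then show ?thesis
    using sturdiness_le[of 1 n 2 \<F>] sturdiness_le[of 2 n 1 \<F>] assms(4)
    unfolding card_tr by simp
qed

theorem theorem5p5:
  fixes n w :: nat and \<F> :: "nat set set"
  assumes "n \<ge> 2"
    and "w < n"
    and "\<F> \<subseteq> Pow {1..n}"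
    and "\<forall>F\<in>\<F>. \<forall>F'\<in>\<F>. card (sym_diff F F') \<le> w"
  shows "(\<forall>s::nat. w = 2 * s \<longrightarrow>
            sturdiness n \<F> \<le> (\<Sum>j<s. (n - 2) choose j)) \<and>
         (\<forall>s::nat. w = 2 * s + 1 \<longrightarrow>
            sturdiness n \<F> \<le> (\<Sum>j<s. (n - 2) choose j) +
              (if s = 0 then 0 else (n - 3) choose (s - 1)))"
proof (intro conjI allI impI)
  fix s assume "w = 2 * s"
  then show "sturdiness n \<F> \<le> (\<Sum>j<s. (n - 2) choose j)"
    using sturdiness_diameter_bound[OF assms(3,4), of s 0 "n - 2"] assms(1,2) by simp
next
  fix s assume w: "w = 2 * s + 1"
  show "sturdiness n \<F> \<le> (\<Sum>j<s. (n - 2) choose j) + (if s = 0 then 0 else (n - 3) choose (s - 1))"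
  proof (cases s)
    case 0
    \<comment> \<open>Here \<open>w = 1\<close>, so the alternative \<open>w < 2\<close> permits
      \<open>t = 0\<close> and \<open>c = 0\<close>; taking \<open>c = 1\<close> would exclude
      \<open>n = 2\<close>.\<close>
    then show ?thesis
      using sturdiness_diameter_bound[OF assms(3,4), of 0 0 "n - 2"] assms(1) w by simp
  next
    case (Suc u)
    define k where "k = n - 3"
    have k: "n = k + 3" using assms(2) w Suc by (simp add: k_def)
    have "sturdiness n \<F> \<le> 2 * (\<Sum>j<s. k choose j)"
      using sturdiness_diameter_bound[OF assms(3,4), of s 1 k] assms(2) w k by simp
    \<comment> \<open>Pascal's rule merges one copy of the sum with the other copy short of its top
      term, which is left over.\<close>
    also have "\<dots> = (\<Sum>j<s. Suc k choose j) + (k choose u)"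
      by (simp only: Suc sum_choose_Suc) simp
    finally show ?thesis using k Suc by (simp add: numeral_3_eq_3)
  qed
qed

end
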